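(* For every $\alpha\in(0,3/2)$ and every $\varepsilon>0$ there exists a positive constant $\gamma=\gamma(\alpha,\varepsilon)$ such that $$(-\Delta)^\alpha\ge V$$ in the sense of quadratic forms on $\ell^2(\mathbb{N})$, where $V$ is the diagonal operator with entries $$V_n=V_n(\alpha,\varepsilon):=\frac{\gamma}{n^{\max(1,2\alpha)+\varepsilon}},\qquad n\in\mathbb{N}.$$
   Context: $\mathbb{N}=\{1,2,3,\dots\}$. The discrete Laplacian on the half line is the bounded self-adjoint operator $-\Delta$ on $\ell^2(\mathbb{N})$ given by $(-\Delta u)_n := -u_{n-1}+2u_n-u_{n+1}$ for $n\in\mathbb{N}$, with the convention $u_0:=0$; its spectrum is $[0,4]$. For $\alpha>0$, the power $(-\Delta)^\alpha$ is defined by the functional calculus. The inequality $(-\Delta)^\alpha\ge V$ means $\langle\psi,((-\Delta)^\alpha-V)\psi\rangle\ge0$ for all $\psi\in\ell^2(\mathbb{N})$. *)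

theory Defs
  imports "HOL-Analysis.Analysis" "HOL-Computational_Algebra.Polynomial"
begin

section \<open>The complex Hilbert space of square-summable sequences on 1, 2, 3, ...\<close>

text \<open>
  A sequence indexed by the positive integers is a function on \<^typ>\<open>nat\<close> whose value at the
  boundary point 0 is 0.
\<close>

typedef ell2 = "{u :: nat \<Rightarrow> complex. u 0 = 0 \<and> summable (\<lambda>n. (cmod (u n))\<^sup>2)}"
  morphisms seq Abs_ell2
  by (rule exI[of _ "\<lambda>_. 0"]) simp

setup_lifting type_definition_ell2

lemma seq_0 [simp]: "seq u 0 = 0"
  and summable_seq: "summable (\<lambda>n. (cmod (seq u n))\<^sup>2)"
  using seq[of u] by auto

lemma ell2_eqI: "(\<And>n. seq u n = seq v n) \<Longrightarrow> u = v"
  by (simp add: seq_inject[symmetric] fun_eq_iff)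

lemma cmod_add_sq_le: "(cmod (a + b))\<^sup>2 \<le> 2 * (cmod a)\<^sup>2 + 2 * (cmod b)\<^sup>2"
proof -
  have "(cmod (a + b))\<^sup>2 \<le> (cmod a + cmod b)\<^sup>2"
    by (simp add: norm_triangle_ineq power_mono)
  also have "\<dots> \<le> 2 * (cmod a)\<^sup>2 + 2 * (cmod b)\<^sup>2"
    using sum_squares_ge_zero[of "cmod a - cmod b" 0] by (simp add: power2_eq_square algebra_simps)
  finally show ?thesis .
qed

lemma summable_sq_add:
  assumes "summable (\<lambda>n. (cmod (f n))\<^sup>2)" "summable (\<lambda>n. (cmod (g n))\<^sup>2)"
  shows "summable (\<lambda>n. (cmod (f n + g n))\<^sup>2)"
  by (rule summable_comparison_test'[where N = 0 and
        g = "\<lambda>n. 2 * (cmod (f n))\<^sup>2 + 2 * (cmod (g n))\<^sup>2"])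
     (use assms cmod_add_sq_le in \<open>auto intro!: summable_add summable_mult\<close>)

lemma summable_sq_scale:
  assumes "summable (\<lambda>n. (cmod (f n))\<^sup>2)"
  shows "summable (\<lambda>n. (cmod (c * f n))\<^sup>2)"
  using assms by (auto simp: norm_mult power_mult_distrib intro: summable_mult)

lemma summable_norm_mult_seq: "summable (\<lambda>n. cmod (seq u n) * cmod (seq v n))"
proof (rule summable_comparison_test'[where N = 0 and
        g = "\<lambda>n. (cmod (seq u n))\<^sup>2 + (cmod (seq v n))\<^sup>2"])
  fix n
  have "0 \<le> (cmod (seq u n) - cmod (seq v n))\<^sup>2 + (cmod (seq u n))\<^sup>2 + (cmod (seq v n))\<^sup>2"
    by simp
  then show "norm (cmod (seq u n) * cmod (seq v n)) \<le> (cmod (seq u n))\<^sup>2 + (cmod (seq v n))\<^sup>2"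
    by (simp add: power2_eq_square algebra_simps)
qed (intro summable_add summable_seq)

definition cinner :: "ell2 \<Rightarrow> ell2 \<Rightarrow> complex" where
  "cinner u v = (\<Sum>n. cnj (seq u n) * seq v n)"

lemma summable_cinner: "summable (\<lambda>n. cnj (seq u n) * seq v n)"
  using summable_norm_mult_seq[of u v]
  by - (rule summable_norm_cancel, simp add: norm_mult)

instantiation ell2 :: real_vector
begin

lift_definition zero_ell2 :: ell2 is "\<lambda>_. 0" by simp

lift_definition plus_ell2 :: "ell2 \<Rightarrow> ell2 \<Rightarrow> ell2" is "\<lambda>u v n. u n + v n"
  by (auto intro!: summable_sq_add)

lift_definition uminus_ell2 :: "ell2 \<Rightarrow> ell2" is "\<lambda>u n. - u n"
  by simp

lift_definition minus_ell2 :: "ell2 \<Rightarrow> ell2 \<Rightarrow> ell2" is "\<lambda>u v n. u n - v n"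
  subgoal for f g using summable_sq_add[of f "\<lambda>n. - g n"] by simp
  done

lift_definition scaleR_ell2 :: "real \<Rightarrow> ell2 \<Rightarrow> ell2" is "\<lambda>c u n. of_real c * u n"
  by (auto intro!: summable_sq_scale)

instance
proof
  note rep = zero_ell2.rep_eq plus_ell2.rep_eq uminus_ell2.rep_eq minus_ell2.rep_eq scaleR_ell2.rep_eq
  fix x y z :: ell2 and a b :: real
  show "x + y + z = x + (y + z)" by (rule ell2_eqI) (simp add: rep add.assoc)
  show "x + y = y + x" by (rule ell2_eqI) (simp add: rep add.commute)
  show "0 + x = x" by (rule ell2_eqI) (simp add: rep)
  show "- x + x = 0" by (rule ell2_eqI) (simp add: rep)
  show "x - y = x + - y" by (rule ell2_eqI) (simp add: rep)
  show "a *\<^sub>R (x + y) = a *\<^sub>R x + a *\<^sub>R y" by (rule ell2_eqI) (simp add: rep distrib_left)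
  show "(a + b) *\<^sub>R x = a *\<^sub>R x + b *\<^sub>R x" by (rule ell2_eqI) (simp add: rep distrib_right)
  show "a *\<^sub>R b *\<^sub>R x = (a * b) *\<^sub>R x" by (rule ell2_eqI) (simp add: rep mult.assoc)
  show "1 *\<^sub>R x = x" by (rule ell2_eqI) (simp add: rep)
qed

end

lemma seq_simps [simp]:
  "seq 0 n = 0" "seq (u + v) n = seq u n + seq v n" "seq (u - v) n = seq u n - seq v n"
  "seq (- u) n = - seq u n" "seq (a *\<^sub>R u) n = of_real a * seq u n"
  by (simp_all add: zero_ell2.rep_eq plus_ell2.rep_eq uminus_ell2.rep_eq minus_ell2.rep_eq
      scaleR_ell2.rep_eq)

instantiation ell2 :: real_inner
begin

definition inner_ell2 :: "ell2 \<Rightarrow> ell2 \<Rightarrow> real" where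
  "inner_ell2 u v = Re (cinner u v)"

definition norm_ell2 :: "ell2 \<Rightarrow> real" where
  "norm_ell2 u = sqrt (\<Sum>n. (cmod (seq u n))\<^sup>2)"

definition dist_ell2 :: "ell2 \<Rightarrow> ell2 \<Rightarrow> real" where
  "dist_ell2 u v = norm (u - v)"

definition sgn_ell2 :: "ell2 \<Rightarrow> ell2" where
  "sgn_ell2 u = u /\<^sub>R norm u"

definition uniformity_ell2 :: "(ell2 \<times> ell2) filter" where
  "uniformity_ell2 = (INF e\<in>{0 <..}. principal {(x, y). dist x y < e})"

definition open_ell2 :: "ell2 set \<Rightarrow> bool" where
  "open_ell2 U \<longleftrightarrow> (\<forall>x\<in>U. eventually (\<lambda>(x', y). x' = x \<longrightarrow> y \<in> U) uniformity)"

instance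
proof
  fix x y z :: ell2 and a :: real
  show "sgn x = x /\<^sub>R norm x" by (rule sgn_ell2_def)
  show "dist x y = norm (x - y)" by (rule dist_ell2_def)
  show "(uniformity :: (ell2 \<times> ell2) filter) = (INF e\<in>{0 <..}. principal {(x, y). dist x y < e})"
    by (rule uniformity_ell2_def)
  show "open U \<longleftrightarrow> (\<forall>x\<in>U. \<forall>\<^sub>F (x', y) in uniformity. x' = x \<longrightarrow> y \<in> U)" for U :: "ell2 set"
    by (rule open_ell2_def)
  have Re_cinner: "Re (cinner u v) = (\<Sum>n. Re (cnj (seq u n) * seq v n))" for u v
    unfolding cinner_def using summable_cinner by (rule Re_suminf)
  have summ: "summable (\<lambda>n. Re (cnj (seq u n) * seq v n))" for u v
    using summable_cinner by (rule summable_Re)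
  show "inner x y = inner y x"
    unfolding inner_ell2_def Re_cinner by (simp add: algebra_simps)
  show "inner (x + y) z = inner x z + inner y z"
    unfolding inner_ell2_def Re_cinner
    by (subst suminf_add[OF summ summ]) (simp add: algebra_simps)
  show "inner (a *\<^sub>R x) y = a * inner x y"
    unfolding inner_ell2_def Re_cinner
    by (subst suminf_mult[OF summ, symmetric]) (simp add: algebra_simps)
  have *: "inner x x = (\<Sum>n. (cmod (seq x n))\<^sup>2)"
    unfolding inner_ell2_def Re_cinner by (simp add: cmod_def power2_eq_square)
  show "0 \<le> inner x x"
    unfolding * by (intro suminf_nonneg summable_seq) simp
  show "inner x x = 0 \<longleftrightarrow> x = 0"
    unfolding * using summable_seq[of x]
    by (subst suminf_eq_zero_iff) (auto simp: fun_eq_iff seq_inject[symmetric])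
  show "norm x = sqrt (inner x x)"
    unfolding * norm_ell2_def ..
qed

end

lemma norm_ell2_sq: "(norm u)\<^sup>2 = (\<Sum>n. (cmod (seq u n))\<^sup>2)" for u :: ell2
  unfolding norm_ell2_def by (intro real_sqrt_pow2 suminf_nonneg summable_seq) simp

lemma sum_seq_le_norm: "(\<Sum>n<k. (cmod (seq u n))\<^sup>2) \<le> (norm u)\<^sup>2"
  unfolding norm_ell2_sq by (intro sum_le_suminf summable_seq) auto

lemma cmod_seq_le_norm: "cmod (seq u n) \<le> norm u"
proof (rule power2_le_imp_le)
  have "(cmod (seq u n))\<^sup>2 \<le> (\<Sum>k<Suc n. (cmod (seq u k))\<^sup>2)"
    by (simp add: sum_nonneg)
  also have "\<dots> \<le> (norm u)\<^sup>2" by (rule sum_seq_le_norm)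
  finally show "(cmod (seq u n))\<^sup>2 \<le> (norm u)\<^sup>2" .
qed simp

lemma norm_ell2_leI:
  assumes "\<And>k. (\<Sum>n<k. (cmod (seq u n))\<^sup>2) \<le> c\<^sup>2" "0 \<le> c"
  shows "norm u \<le> c"
proof (rule power2_le_imp_le)
  show "(norm u)\<^sup>2 \<le> c\<^sup>2"
    unfolding norm_ell2_sq using assms(1) by (intro suminf_le_const summable_seq)
qed fact

instance ell2 :: banach
proof
  fix X :: "nat \<Rightarrow> ell2"
  assume "Cauchy X"
  have "Cauchy (\<lambda>m. seq (X m) n)" for n
  proof (rule CauchyI)
    fix e :: real assume "0 < e"
    with \<open>Cauchy X\<close> obtain M where M: "\<And>i j. i \<ge> M \<Longrightarrow> j \<ge> M \<Longrightarrow> norm (X i - X j) < e"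
      unfolding Cauchy_iff by metis
    show "\<exists>M. \<forall>i\<ge>M. \<forall>j\<ge>M. norm (seq (X i) n - seq (X j) n) < e"
    proof (intro exI allI impI)
      fix i j assume "i \<ge> M" "j \<ge> M"
      show "norm (seq (X i) n - seq (X j) n) < e"
        using cmod_seq_le_norm[of "X i - X j" n] M[OF \<open>i \<ge> M\<close> \<open>j \<ge> M\<close>] by simp
    qed
  qed
  then have "\<forall>n. \<exists>l. (\<lambda>m. seq (X m) n) \<longlonglongrightarrow> l"
    using Cauchy_convergent by (auto simp: convergent_def)
  then obtain x where x: "\<And>n. (\<lambda>m. seq (X m) n) \<longlonglongrightarrow> x n"
    by metis
  have tail: "\<exists>M. \<forall>i\<ge>M. \<forall>k. (\<Sum>n<k. (cmod (seq (X i) n - x n))\<^sup>2) \<le> e\<^sup>2" if e: "0 < e" for e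
  proof -
    from \<open>Cauchy X\<close> e obtain M where M: "\<And>i j. i \<ge> M \<Longrightarrow> j \<ge> M \<Longrightarrow> norm (X i - X j) < e"
      unfolding Cauchy_iff by metis
    have "(\<Sum>n<k. (cmod (seq (X i) n - x n))\<^sup>2) \<le> e\<^sup>2" if "i \<ge> M" for i k
    proof (rule Lim_bounded)
      show "(\<lambda>j. \<Sum>n<k. (cmod (seq (X i) n - seq (X j) n))\<^sup>2)
              \<longlonglongrightarrow> (\<Sum>n<k. (cmod (seq (X i) n - x n))\<^sup>2)"
        by (intro tendsto_intros x)
      show "\<forall>j\<ge>M. (\<Sum>n<k. (cmod (seq (X i) n - seq (X j) n))\<^sup>2) \<le> e\<^sup>2"
      proof (intro allI impI)
        fix j assume "j \<ge> M"
        have "(\<Sum>n<k. (cmod (seq (X i) n - seq (X j) n))\<^sup>2) \<le> (norm (X i - X j))\<^sup>2"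
          using sum_seq_le_norm[of "X i - X j" k] by simp
        also have "\<dots> \<le> e\<^sup>2"
          using M[OF \<open>i \<ge> M\<close> \<open>j \<ge> M\<close>] by (intro power_mono) auto
        finally show "(\<Sum>n<k. (cmod (seq (X i) n - seq (X j) n))\<^sup>2) \<le> e\<^sup>2" .
      qed
    qed
    then show ?thesis by blast
  qed
  from tail[of 1] obtain M where M: "\<And>k. (\<Sum>n<k. (cmod (seq (X M) n - x n))\<^sup>2) \<le> 1"
    by auto
  have "summable (\<lambda>n. (cmod (seq (X M) n - x n))\<^sup>2)"
    using M by (intro summableI_nonneg_bounded[where x = 1]) auto
  then have "summable (\<lambda>n. (cmod (seq (X M) n + (- 1) * (seq (X M) n - x n)))\<^sup>2)"
    by (intro summable_sq_add summable_sq_scale summable_seq)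
  moreover have "x 0 = 0"
    using x[of 0] by (simp add: LIMSEQ_const_iff)
  ultimately have seq_x: "seq (Abs_ell2 x) = x"
    by (intro Abs_ell2_inverse) simp
  have "X \<longlonglongrightarrow> Abs_ell2 x"
  proof (rule LIMSEQ_I)
    fix r :: real assume "0 < r"
    with tail[of "r / 2"] obtain M
      where M: "\<And>i k. i \<ge> M \<Longrightarrow> (\<Sum>n<k. (cmod (seq (X i) n - x n))\<^sup>2) \<le> (r / 2)\<^sup>2"
      by auto
    have "norm (X i - Abs_ell2 x) \<le> r / 2" if "i \<ge> M" for i
      using M[OF that] \<open>0 < r\<close> by (intro norm_ell2_leI) (simp_all add: seq_x)
    with \<open>0 < r\<close> show "\<exists>M. \<forall>i\<ge>M. norm (X i - Abs_ell2 x) < r"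
      by (intro exI[of _ M]) force
  qed
  then show "convergent X" by (auto simp: convergent_def)
qed


section \<open>Spectrum and continuous functional calculus\<close>

lift_definition cscale :: "complex \<Rightarrow> ell2 \<Rightarrow> ell2" is "\<lambda>z u n. z * u n"
  by (auto intro!: summable_sq_scale)

lemma norm_cscale: "norm (cscale z u) = cmod z * norm u"
  unfolding norm_ell2_def
  by (simp add: cscale.rep_eq norm_mult power_mult_distrib suminf_mult summable_seq real_sqrt_mult)

lift_definition cscale_op :: "complex \<Rightarrow> ell2 \<Rightarrow>\<^sub>L ell2" is cscale
proof (rule bounded_linear_intro)
  show "norm (cscale z u) \<le> norm u * cmod z" for z u
    by (simp add: norm_cscale)
qed (simp_all add: seq_inject[symmetric] fun_eq_iff cscale.rep_eq algebra_simps)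

text \<open>
  \<^typ>\<open>ell2 \<Rightarrow>\<^sub>L ell2\<close> is the type of bounded real-linear operators. The inverse of a
  complex-linear operator is complex-linear, so for complex-linear operators, the only
  ones used here, this is the usual spectrum.
\<close>

definition spectrum :: "(ell2 \<Rightarrow>\<^sub>L ell2) \<Rightarrow> complex set" where
  "spectrum A = {z. \<nexists>B. B o\<^sub>L (A - cscale_op z) = id_blinfun \<and> (A - cscale_op z) o\<^sub>L B = id_blinfun}"

definition poly_op :: "real poly \<Rightarrow> (ell2 \<Rightarrow>\<^sub>L ell2) \<Rightarrow> (ell2 \<Rightarrow>\<^sub>L ell2)" where
  "poly_op p A = (\<Sum>i\<le>degree p. coeff p i *\<^sub>R (((o\<^sub>L) A ^^ i) id_blinfun))"

text \<open>
  For self-adjoint \<open>A\<close> and real \<open>f\<close> continuous on the (real) spectrum of \<open>A\<close>, the operator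
  \<open>f(A)\<close> is the operator-norm limit of \<open>p\<^sub>n(A)\<close> for any real polynomials \<open>p\<^sub>n\<close> converging
  to \<open>f\<close> uniformly on the spectrum. Such polynomials exist by Weierstrass, and the limit does
  not depend on their choice because the norm of \<open>p(A)\<close> is the supremum of \<open>\<bar>p\<bar>\<close> on the
  spectrum.
\<close>

definition fun_calc :: "(real \<Rightarrow> real) \<Rightarrow> (ell2 \<Rightarrow>\<^sub>L ell2) \<Rightarrow> (ell2 \<Rightarrow>\<^sub>L ell2)" where
  "fun_calc f A = (THE T. \<exists>p :: nat \<Rightarrow> real poly.
     uniform_limit {x. complex_of_real x \<in> spectrum A} (\<lambda>n. poly (p n)) f sequentially \<and>
     (\<lambda>n. poly_op (p n) A) \<longlonglongrightarrow> T)"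


section \<open>The discrete Laplacian and diagonal operators\<close>

lemma summable_sq_shift:
  assumes "summable (\<lambda>n. (cmod (f n))\<^sup>2)"
  shows "summable (\<lambda>n. (cmod (f (n - 1)))\<^sup>2)" "summable (\<lambda>n. (cmod (f (n + 1)))\<^sup>2)"
  using assms summable_Suc_iff[of "\<lambda>n. (cmod (f (n - 1)))\<^sup>2"]
    summable_Suc_iff[of "\<lambda>n. (cmod (f n))\<^sup>2"] by simp_all

lift_definition neg_laplacian_fun :: "ell2 \<Rightarrow> ell2" is
  "\<lambda>u n. if n = 0 then 0 else - u (n - 1) + 2 * u n - u (n + 1)"
proof (intro CollectI conjI)
  fix u :: "nat \<Rightarrow> complex"
  assume u: "u 0 = 0 \<and> summable (\<lambda>n. (cmod (u n))\<^sup>2)"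
  then have "summable (\<lambda>n. (cmod ((- 1) * u (n - 1) + 2 * u n + (- 1) * u (n + 1)))\<^sup>2)"
    by (intro summable_sq_add summable_sq_scale summable_sq_shift) auto
  then show "summable (\<lambda>n. (cmod (if n = 0 then 0 else - u (n - 1) + 2 * u n - u (n + 1)))\<^sup>2)"
    by (rule summable_comparison_test'[where N = 0]) auto
qed simp

lemma bounded_linear_neg_laplacian: "bounded_linear neg_laplacian_fun"
proof (rule bounded_linear_intro)
  fix u v :: ell2 and r :: real
  show "neg_laplacian_fun (u + v) = neg_laplacian_fun u + neg_laplacian_fun v"
    "neg_laplacian_fun (r *\<^sub>R u) = r *\<^sub>R neg_laplacian_fun u"
    by (simp_all add: seq_inject[symmetric] fun_eq_iff neg_laplacian_fun.rep_eq algebra_simps)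
  let ?S = "\<lambda>f. \<Sum>n. (cmod (f n))\<^sup>2"
  let ?u = "seq u"
  note s = summable_seq[of u]
  note sh = summable_sq_shift[OF s]
  have l: "?S (\<lambda>n. ?u (n - 1)) = (norm u)\<^sup>2"
    using suminf_split_head[OF sh(1)] by (simp add: norm_ell2_sq)
  have r: "?S (\<lambda>n. ?u (n + 1)) = (norm u)\<^sup>2"
    using suminf_split_head[OF s] by (simp add: norm_ell2_sq)
  have "(norm (neg_laplacian_fun u))\<^sup>2 = ?S (seq (neg_laplacian_fun u))"
    by (rule norm_ell2_sq)
  also have "\<dots> \<le> (\<Sum>n. 4 * (cmod (?u (n - 1)))\<^sup>2 + 16 * (cmod (?u n))\<^sup>2 + 2 * (cmod (?u (n + 1)))\<^sup>2)"
  proof (intro suminf_le summable_add summable_mult sh s summable_seq)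
    fix n
    show "(cmod (seq (neg_laplacian_fun u) n))\<^sup>2
        \<le> 4 * (cmod (?u (n - 1)))\<^sup>2 + 16 * (cmod (?u n))\<^sup>2 + 2 * (cmod (?u (n + 1)))\<^sup>2"
      using cmod_add_sq_le[of "- ?u (n - 1) + 2 * ?u n" "- ?u (n + 1)"]
        cmod_add_sq_le[of "- ?u (n - 1)" "2 * ?u n"]
      by (auto simp add: neg_laplacian_fun.rep_eq norm_mult power_mult_distrib)
  qed
  also have "\<dots> = 4 * (norm u)\<^sup>2 + 16 * (norm u)\<^sup>2 + 2 * (norm u)\<^sup>2"
  proof -
    have "(\<Sum>n. 4 * (cmod (?u (n - 1)))\<^sup>2 + 16 * (cmod (?u n))\<^sup>2 + 2 * (cmod (?u (n + 1)))\<^sup>2)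
        = 4 * ?S (\<lambda>n. ?u (n - 1)) + 16 * ?S ?u + 2 * ?S (\<lambda>n. ?u (n + 1))"
      by (simp only: suminf_add[symmetric] suminf_mult summable_add summable_mult sh s)
    then show ?thesis by (simp only: l r norm_ell2_sq)
  qed
  also have "\<dots> \<le> (norm u * 5)\<^sup>2"
    by (simp add: power_mult_distrib)
  finally show "norm (neg_laplacian_fun u) \<le> norm u * 5"
    by (rule power2_le_imp_le) simp
qed

lift_definition neg_laplacian :: "ell2 \<Rightarrow>\<^sub>L ell2" is neg_laplacian_fun
  by (rule bounded_linear_neg_laplacian)

definition neg_laplacian_pow :: "real \<Rightarrow> ell2 \<Rightarrow>\<^sub>L ell2" where
  "neg_laplacian_pow \<alpha> = fun_calc (\<lambda>x. x powr \<alpha>) neg_laplacian"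

text \<open>Meaningful for bounded real \<open>v\<close>; the entry \<open>v 0\<close> is irrelevant.\<close>

definition diag_op :: "(nat \<Rightarrow> real) \<Rightarrow> ell2 \<Rightarrow>\<^sub>L ell2" where
  "diag_op v = Blinfun (\<lambda>u. Abs_ell2 (\<lambda>n. of_real (v n) * seq u n))"

lemma seq_diag_op:
  assumes v: "\<And>n. \<bar>v n\<bar> \<le> C"
  shows "seq (diag_op v u) n = of_real (v n) * seq u n"
proof -
  have le: "(cmod (of_real (v n) * seq u n))\<^sup>2 \<le> C\<^sup>2 * (cmod (seq u n))\<^sup>2" for u n
    using power_mono[OF v[of n], of 2] by (auto simp: norm_mult power_mult_distrib intro!: mult_right_mono)
  have s: "summable (\<lambda>n. C\<^sup>2 * (cmod (seq u n))\<^sup>2)" for u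
    by (intro summable_mult summable_seq)
  have seq: "seq (Abs_ell2 (\<lambda>n. of_real (v n) * seq u n)) = (\<lambda>n. of_real (v n) * seq u n)" for u
    using summable_comparison_test'[OF s[of u], of 0 "\<lambda>n. (cmod (of_real (v n) * seq u n))\<^sup>2"] le
    by (intro Abs_ell2_inverse) auto
  have "bounded_linear (\<lambda>u. Abs_ell2 (\<lambda>n. of_real (v n) * seq u n))"
  proof (rule bounded_linear_intro)
    fix u w :: ell2 and r :: real
    let ?D = "\<lambda>u. Abs_ell2 (\<lambda>n. of_real (v n) * seq u n)"
    show "?D (u + w) = ?D u + ?D w"
      by (rule ell2_eqI, subst seq) (simp add: seq distrib_left)
    show "?D (r *\<^sub>R u) = r *\<^sub>R ?D u"
      by (rule ell2_eqI, subst seq) (simp add: seq mult.left_commute)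
    have "0 \<le> C" using v[of 0] by linarith
    have "(norm (?D u))\<^sup>2 \<le> (\<Sum>n. C\<^sup>2 * (cmod (seq u n))\<^sup>2)"
      unfolding norm_ell2_sq using le summable_seq[of "?D u"]
      by (intro suminf_le s) (simp_all add: seq)
    also have "\<dots> = (norm u * C)\<^sup>2"
      by (simp add: suminf_mult summable_seq norm_ell2_sq power_mult_distrib)
    finally show "norm (?D u) \<le> norm u * C"
      by (rule power2_le_imp_le) (simp add: \<open>0 \<le> C\<close>)
  qed
  then show ?thesis
    by (simp add: diag_op_def bounded_linear_Blinfun_apply seq)
qed

end

theory Submission
  imports Defs
begin

text \<open>
  Because \<open>\<epsilon>\<close> is positive, the inequality follows from pointwise bounds: if each entry satisfies
  \<open>\<bar>u\<^sub>n\<bar>\<^sup>2 \<le> C n powr s * \<langle>u, (-\<Delta>)\<^sup>\<alpha> u\<rangle>\<close> with an exponent \<open>s < max 1 (2\<alpha>) - 1 + \<epsilon>\<close>, then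
  dividing by \<open>n powr (max 1 (2\<alpha>) + \<epsilon>)\<close> and summing over \<open>n\<close> proves the inequality with
  \<open>\<gamma> = 1 / (C Z)\<close>, where \<open>Z = \<Sum>\<^sub>n n powr (s - max 1 (2\<alpha>) - \<epsilon>)\<close> is finite.

  The pointwise bounds come from the sine transform \<open>S u(\<theta>) = \<Sum>\<^sub>n u\<^sub>n sin (n\<theta>)\<close> on \<open>[0,\<pi>]\<close>, in which
  \<open>-\<Delta>\<close> is multiplication by \<open>2 - 2 cos \<theta>\<close>. The entry \<open>u\<^sub>n\<close> is the integral of \<open>S u(\<theta>)\<close> against
  \<open>sin (n\<theta>)\<close>, up to a factor, and Cauchy--Schwarz with the weight \<open>(2 - 2 cos \<theta>) powr \<alpha>\<close>, of order
  \<open>\<theta> powr (2\<alpha>)\<close>, leaves the integral of \<open>sin\<^sup>2 (n\<theta>) \<theta> powr (-2\<alpha>)\<close>. By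
  \<open>sin\<^sup>2 (n\<theta>) \<le> (n\<theta>) powr s\<close> for \<open>0 \<le> s \<le> 2\<close>, it is \<open>O(n powr s)\<close> as soon as \<open>s > 2\<alpha> - 1\<close>. Such an
  \<open>s \<le> 2\<close> exists because \<open>\<alpha> < 3/2\<close>. This is the lemma \<open>coefficient_bound\<close>.

  The power \<open>(-\<Delta>)\<^sup>\<alpha>\<close> is given as a norm limit of polynomials, characterised through the spectrum.
  To identify its form as the integral of \<open>(2 - 2 cos \<theta>) powr \<alpha> * \<bar>S u(\<theta>)\<bar>\<^sup>2\<close> (lemma \<open>form_integral\<close>),
  the calculus is developed for this one operator. The Parseval identity gives
  \<open>\<parallel>p(-\<Delta>)\<parallel> \<le> sup \<bar>p\<bar>\<close> over \<open>(0,4)\<close>. Together with \<open>(0,4) \<subseteq> \<real> \<inter> \<sigma>(-\<Delta>) \<subseteq> [0,4]\<close> and the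
  Weierstrass theorem, this makes the limit exist and be unique (lemma \<open>fun_calc_laplacian\<close>).

  Transforms are only ever taken of finitely supported sequences, where all sums are finite. Since
  such sequences are dense and the form is continuous, nonnegativity extends to the whole space.
\<close>

section \<open>Finitely supported sequences\<close>

definition supp_below :: "nat \<Rightarrow> ell2 \<Rightarrow> bool" where
  "supp_below N u \<longleftrightarrow> (\<forall>n\<ge>N. seq u n = 0)"

interpretation blinfun_compose: bounded_bilinear "(o\<^sub>L)"
  by (rule bounded_bilinear_blinfun_compose)

lemma supp_below_mono: "supp_below N u \<Longrightarrow> N \<le> M \<Longrightarrow> supp_below M u"
  by (auto simp: supp_below_def)

lift_definition trunc :: "nat \<Rightarrow> ell2 \<Rightarrow> ell2" is "\<lambda>N u n. if n < N then u n else 0"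
proof (intro CollectI conjI)
  fix N and u :: "nat \<Rightarrow> complex"
  assume "u 0 = 0 \<and> summable (\<lambda>n. (cmod (u n))\<^sup>2)"
  then have "summable (\<lambda>n. (cmod (u n))\<^sup>2)" by simp
  then show "summable (\<lambda>n. (cmod (if n < N then u n else 0))\<^sup>2)"
    by (rule summable_comparison_test'[where N = 0]) auto
qed simp

lemma supp_below_trunc: "supp_below N (trunc N u)"
  by (simp add: supp_below_def trunc.rep_eq)

lemma norm_supp_below:
  assumes "supp_below N u"
  shows "(norm u)\<^sup>2 = (\<Sum>n<N. (cmod (seq u n))\<^sup>2)"
  unfolding norm_ell2_sq using assms
  by (intro suminf_finite) (auto simp: supp_below_def)

lemma cinner_supp_below:
  assumes "supp_below N u"
  shows "cinner u v = (\<Sum>n<N. cnj (seq u n) * seq v n)"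
  unfolding cinner_def using assms
  by (intro suminf_finite) (auto simp: supp_below_def)

text \<open>
  The squared error of the truncation is the tail of the convergent series of the squared norm;
  hence the truncations converge in norm, and finitely supported sequences are dense.
\<close>

lemma norm_minus_trunc: "(norm (u - trunc N u))\<^sup>2 = (norm u)\<^sup>2 - (\<Sum>n<N. (cmod (seq u n))\<^sup>2)"
proof -
  have "(norm (u - trunc N u))\<^sup>2 =
      (\<Sum>n. (cmod (seq (u - trunc N u) (n + N)))\<^sup>2) + (\<Sum>n<N. (cmod (seq (u - trunc N u) n))\<^sup>2)"
    unfolding norm_ell2_sq by (rule suminf_split_initial_segment[OF summable_seq])
  also have "\<dots> = (\<Sum>n. (cmod (seq u (n + N)))\<^sup>2)"
    by (simp add: trunc.rep_eq)
  also have "\<dots> = (norm u)\<^sup>2 - (\<Sum>n<N. (cmod (seq u n))\<^sup>2)"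
    unfolding norm_ell2_sq by (rule suminf_minus_initial_segment[OF summable_seq])
  finally show ?thesis .
qed

lemma tendsto_trunc: "(\<lambda>N. trunc N u) \<longlonglongrightarrow> u"
proof -
  have "(\<lambda>N. (norm u)\<^sup>2 - (\<Sum>n<N. (cmod (seq u n))\<^sup>2)) \<longlonglongrightarrow> (norm u)\<^sup>2 - (norm u)\<^sup>2"
    unfolding norm_ell2_sq by (intro tendsto_intros summable_LIMSEQ summable_seq)
  then have "(\<lambda>N. sqrt ((norm (u - trunc N u))\<^sup>2)) \<longlonglongrightarrow> sqrt 0"
    by (intro tendsto_real_sqrt) (simp add: norm_minus_trunc)
  then have "(\<lambda>N. norm (trunc N u - u)) \<longlonglongrightarrow> 0"
    by (simp add: norm_minus_commute)
  then show ?thesis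
    by (simp add: tendsto_norm_zero_iff LIM_zero_iff)
qed

text \<open>
  Multiplying the first argument by \<open>\<i>\<close> turns the imaginary part of the complex inner product into a
  real inner product. This transfers linearity and continuity from the real inner product space
  to \<^const>\<open>cinner\<close>.
\<close>

lemma cinner_eq_inner: "cinner u v = Complex (inner u v) (inner (cscale \<i> u) v)"
proof -
  have "cinner (cscale \<i> u) v = (\<Sum>n. - \<i> * (cnj (seq u n) * seq v n))"
    by (simp add: cinner_def cscale.rep_eq mult.assoc)
  also have "\<dots> = - \<i> * cinner u v"
    unfolding cinner_def by (rule suminf_mult[OF summable_cinner])
  finally show ?thesis
    by (simp add: inner_ell2_def complex_eq_iff)
qed

lemma tendsto_cinner:
  assumes "(f \<longlongrightarrow> u) F" "(g \<longlongrightarrow> v) F"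
  shows "((\<lambda>x. cinner (f x) (g x)) \<longlongrightarrow> cinner u v) F"
proof -
  have "((\<lambda>x. cscale_op \<i> (f x)) \<longlongrightarrow> cscale_op \<i> u) F"
    by (intro tendsto_intros assms)
  then show ?thesis
    unfolding cinner_eq_inner Complex_eq cscale_op.rep_eq[symmetric]
    by (intro tendsto_intros assms)
qed

section \<open>The sine transform of a finitely supported sequence\<close>

text \<open>
  For finitely supported \<open>u\<close>, this diagonalises the Laplacian on the half line: the Dirichlet condition
  at 0 selects sines, and \<open>\<theta> \<mapsto> 2 - 2 cos \<theta>\<close> is the symbol.
\<close>

definition sine_transform :: "ell2 \<Rightarrow> real \<Rightarrow> complex" where
  "sine_transform u \<theta> = (\<Sum>n. seq u n * of_real (sin (real n * \<theta>)))"

lemma sine_transform_eq: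
  assumes "supp_below N u"
  shows "sine_transform u \<theta> = (\<Sum>n<N. seq u n * of_real (sin (real n * \<theta>)))"
  unfolding sine_transform_def using assms
  by (intro suminf_finite) (auto simp: supp_below_def)

lemma continuous_on_sine_transform:
  assumes "supp_below N u"
  shows "continuous_on S (sine_transform u)"
  unfolding sine_transform_eq[OF assms, abs_def] by (intro continuous_intros)

lemma has_integral_cos_multiple:
  fixes k :: int
  shows "((\<lambda>\<theta>. cos (of_int k * \<theta>)) has_integral (if k = 0 then pi else 0)) {0..pi}"
proof (cases "k = 0")
  case True
  then show ?thesis
    using has_integral_const_real[of "1::real" 0 pi] by simp
next
  case False
  have "((\<lambda>\<theta>. cos (of_int k * \<theta>)) has_integral
      (sin (of_int k * pi) / of_int k - sin (of_int k * 0) / of_int k)) {0..pi}"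
    using False
    by (intro fundamental_theorem_of_calculus)
       (auto intro!: derivative_eq_intros simp: has_real_derivative_iff_has_vector_derivative[symmetric])
  moreover have "sin (of_int k * pi) = 0"
    by (auto simp: sin_zero_iff_int2)
  ultimately show ?thesis
    using False by simp
qed

lemma has_integral_sin_sin:
  assumes "0 < m"
  shows "((\<lambda>\<theta>. sin (real m * \<theta>) * sin (real n * \<theta>)) has_integral (if m = n then pi / 2 else 0)) {0..pi}"
proof -
  have "((\<lambda>\<theta>. (cos (of_int (int m - int n) * \<theta>) - cos (of_int (int m + int n) * \<theta>)) / 2) has_integral
     ((if int m - int n = 0 then pi else 0) - (if int m + int n = 0 then pi else 0)) / 2) {0..pi}"
    by (intro has_integral_divide has_integral_diff has_integral_cos_multiple)
  moreover have "(cos (of_int (int m - int n) * \<theta>) - cos (of_int (int m + int n) * \<theta>)) / 2 =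
      sin (real m * \<theta>) * sin (real n * \<theta>)" for \<theta>
    by (simp add: sin_times_sin ring_distribs)
  ultimately show ?thesis
    using assms by (simp split: if_splits)
qed

text \<open>
  By orthogonality of the functions \<open>sin (n\<theta>)\<close>, the transform determines each entry of the sequence.
  The entry 0 causes no exception, because it vanishes along with \<open>sin 0\<close>.
\<close>

lemma has_integral_sine_coefficient:
  assumes "supp_below N u"
  shows "((\<lambda>\<theta>. sine_transform u \<theta> * of_real (sin (real n * \<theta>))) has_integral
     of_real (pi / 2) * seq u n) {0..pi}"
proof -
  have "((\<lambda>\<theta>. seq u m * of_real (sin (real m * \<theta>) * sin (real n * \<theta>))) has_integral
     seq u m * of_real (if m = n then pi / 2 else 0)) {0..pi}" for m
  proof (cases "m = 0")
    case False
    then show ?thesis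
      by (intro has_integral_mult_right has_integral_of_real has_integral_sin_sin) simp
  qed simp
  then have "((\<lambda>\<theta>. \<Sum>m<N. seq u m * of_real (sin (real m * \<theta>) * sin (real n * \<theta>))) has_integral
     (\<Sum>m<N. seq u m * of_real (if m = n then pi / 2 else 0))) {0..pi}"
    by (intro has_integral_sum) auto
  moreover have "(\<Sum>m<N. seq u m * of_real (if m = n then pi / 2 else 0)) = of_real (pi / 2) * seq u n"
    using assms by (simp add: supp_below_def if_distrib[of "\<lambda>x. _ * complex_of_real x"] cong: if_cong)
  moreover have "(\<Sum>m<N. seq u m * of_real (sin (real m * \<theta>) * sin (real n * \<theta>))) =
      sine_transform u \<theta> * of_real (sin (real n * \<theta>))" for \<theta>
    by (simp add: sine_transform_eq[OF assms] sum_distrib_right mult.assoc)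
  ultimately show ?thesis
    by simp
qed

text \<open>
  The Parseval identity: expand the first factor and recover the entries of \<open>v\<close>.
\<close>

lemma has_integral_cinner:
  assumes "supp_below N u" "supp_below M v"
  shows "((\<lambda>\<theta>. cnj (sine_transform u \<theta>) * sine_transform v \<theta>) has_integral
     of_real (pi / 2) * cinner u v) {0..pi}"
proof -
  have "((\<lambda>\<theta>. \<Sum>n<N. cnj (seq u n) * (sine_transform v \<theta> * of_real (sin (real n * \<theta>)))) has_integral
     (\<Sum>n<N. cnj (seq u n) * (of_real (pi / 2) * seq v n))) {0..pi}"
    by (intro has_integral_sum has_integral_mult_right has_integral_sine_coefficient[OF assms(2)]) auto
  moreover have "(\<Sum>n<N. cnj (seq u n) * (of_real (pi / 2) * seq v n)) = of_real (pi / 2) * cinner u v"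
    by (simp add: cinner_supp_below[OF assms(1)] sum_distrib_left mult_ac)
  moreover have "(\<Sum>n<N. cnj (seq u n) * (sine_transform v \<theta> * of_real (sin (real n * \<theta>)))) =
      cnj (sine_transform u \<theta>) * sine_transform v \<theta>" for \<theta>
    by (simp add: sine_transform_eq[OF assms(1)] sum_distrib_left sum_distrib_right mult_ac)
  ultimately show ?thesis
    by (simp only:)
qed

lemma sine_transform_add:
  assumes "supp_below N u" "supp_below M v"
  shows "sine_transform (u + v) \<theta> = sine_transform u \<theta> + sine_transform v \<theta>"
    and "supp_below (max N M) (u + v)"
proof -
  have "supp_below (max N M) u" "supp_below (max N M) v"
    using assms supp_below_mono by auto
  moreover from this show "supp_below (max N M) (u + v)"
    by (simp add: supp_below_def)
  ultimately show "sine_transform (u + v) \<theta> = sine_transform u \<theta> + sine_transform v \<theta>"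
    by (simp only: sine_transform_eq) (simp add: sum.distrib distrib_right)
qed

lemma sine_transform_scaleR:
  assumes "supp_below N u"
  shows "sine_transform (c *\<^sub>R u) \<theta> = of_real c * sine_transform u \<theta>"
    and "supp_below N (c *\<^sub>R u)"
proof -
  show "supp_below N (c *\<^sub>R u)"
    using assms by (simp add: supp_below_def)
  with assms show "sine_transform (c *\<^sub>R u) \<theta> = of_real c * sine_transform u \<theta>"
    by (simp only: sine_transform_eq) (simp add: sum_distrib_left mult.assoc)
qed

section \<open>Polynomials in the Laplacian\<close>

lemma supp_below_neg_laplacian:
  "supp_below N u \<Longrightarrow> supp_below (Suc N) (neg_laplacian u)"
  by (auto simp: supp_below_def neg_laplacian.rep_eq neg_laplacian_fun.rep_eq)

text \<open>
  Shifting the summation index moves the second difference from \<open>u\<close> to \<open>sin (n\<theta>)\<close>, and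
  \<open>sin ((n+1)\<theta>) + sin ((n-1)\<theta>) = 2 cos \<theta> sin (n\<theta>)\<close>. The boundary terms vanish since
  \<open>u\<^sub>0 = 0 = sin 0\<close>.
\<close>

lemma sine_transform_neg_laplacian:
  assumes "supp_below N u"
  shows "sine_transform (neg_laplacian u) \<theta> = of_real (2 - 2 * cos \<theta>) * sine_transform u \<theta>"
proof -
  let ?s = "\<lambda>n. complex_of_real (sin (real n * \<theta>))"
  have u: "seq u n = 0" if "n \<ge> N" for n
    using assms that by (simp add: supp_below_def)
  have trig: "?s (Suc n) + complex_of_real (sin (real n * \<theta> - \<theta>)) = of_real (2 * cos \<theta>) * ?s n" for n
    unfolding of_real_add[symmetric] of_real_mult[symmetric] of_real_eq_iff
    by (simp add: sin_add sin_diff ring_distribs)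
  have "sine_transform (neg_laplacian u) \<theta> = (\<Sum>n<Suc N. seq (neg_laplacian u) n * ?s n)"
    by (rule sine_transform_eq[OF supp_below_neg_laplacian[OF assms]])
  also have "\<dots> = (\<Sum>n<N. (- seq u n + 2 * seq u (Suc n) - seq u (Suc (Suc n))) * ?s (Suc n))"
    by (simp only: sum.lessThan_Suc_shift) (simp add: neg_laplacian.rep_eq neg_laplacian_fun.rep_eq)
  also have "\<dots> = 2 * (\<Sum>n<N. seq u (Suc n) * ?s (Suc n)) - (\<Sum>n<N. seq u n * ?s (Suc n))
       - (\<Sum>n<N. seq u (Suc (Suc n)) * ?s (Suc n))"
    by (simp add: sum_subtractf sum_negf sum.distrib sum_distrib_left algebra_simps)
  also have "(\<Sum>n<N. seq u (Suc n) * ?s (Suc n)) = (\<Sum>n<N. seq u n * ?s n)"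
    using sum.lessThan_Suc_shift[of "\<lambda>n. seq u n * ?s n" N] u by simp
  also have "(\<Sum>n<N. seq u (Suc (Suc n)) * ?s (Suc n)) =
      (\<Sum>n<N. seq u n * complex_of_real (sin (real n * \<theta> - \<theta>)))"
    using sum.lessThan_Suc_shift[of "\<lambda>n. seq u n * complex_of_real (sin (real n * \<theta> - \<theta>))" N]
      sum.lessThan_Suc_shift[of "\<lambda>n. seq u (Suc n) * ?s n" N] u
    by (simp add: algebra_simps)
  also have "2 * (\<Sum>n<N. seq u n * ?s n) - (\<Sum>n<N. seq u n * ?s (Suc n))
       - (\<Sum>n<N. seq u n * complex_of_real (sin (real n * \<theta> - \<theta>))) =
       (\<Sum>n<N. seq u n * (2 * ?s n - (?s (Suc n) + complex_of_real (sin (real n * \<theta> - \<theta>)))))"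
    by (simp add: sum_subtractf sum.distrib sum_distrib_left algebra_simps)
  also have "\<dots> = of_real (2 - 2 * cos \<theta>) * sine_transform u \<theta>"
    unfolding trig sine_transform_eq[OF assms] by (simp add: sum_distrib_left algebra_simps)
  finally show ?thesis .
qed

lemma poly_op_eq_sum:
  assumes "degree p \<le> N"
  shows "poly_op p A = (\<Sum>i\<le>N. coeff p i *\<^sub>R (((o\<^sub>L) A ^^ i) id_blinfun))"
  unfolding poly_op_def using assms
  by (intro sum.mono_neutral_left) (auto simp: coeff_eq_0)

lemma poly_op_add: "poly_op (p + q) A = poly_op p A + poly_op q A"
proof -
  have "degree (p + q) \<le> max (degree p) (degree q)"
    by (rule degree_add_le_max)
  then show ?thesis
    by (simp add: poly_op_eq_sum[of _ "max (degree p) (degree q)"] scaleR_left_distrib sum.distrib)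
qed

lemma poly_op_smult: "poly_op (smult c p) A = c *\<^sub>R poly_op p A"
proof -
  have "degree (smult c p) \<le> degree p"
    by (rule degree_smult_le)
  then show ?thesis
    by (simp add: poly_op_eq_sum[of _ "degree p"] scaleR_sum_right)
qed

lemma poly_op_diff: "poly_op (p - q) A = poly_op p A - poly_op q A"
  using poly_op_add[of p "smult (- 1) q" A] by (simp only: poly_op_smult) simp

lemma poly_op_pCons: "poly_op (pCons c p) A = c *\<^sub>R id_blinfun + (A o\<^sub>L poly_op p A)"
proof -
  have "degree (pCons c p) \<le> Suc (degree p)"
    by (rule degree_pCons_le)
  then have "poly_op (pCons c p) A =
      c *\<^sub>R id_blinfun + (\<Sum>i\<le>degree p. coeff p i *\<^sub>R (A o\<^sub>L (((o\<^sub>L) A ^^ i) id_blinfun)))"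
    by (simp only: poly_op_eq_sum sum.atMost_Suc_shift) simp
  also have "\<dots> = c *\<^sub>R id_blinfun + (A o\<^sub>L poly_op p A)"
    unfolding poly_op_def
    by (simp only: blinfun_compose.sum_right blinfun_compose.scaleR_right)
  finally show ?thesis .
qed

lemma poly_op_0: "poly_op 0 A = 0"
  by (simp add: poly_op_def)

lemma poly_op_commute: "poly_op p A o\<^sub>L A = A o\<^sub>L poly_op p A"
proof (induction p)
  case (pCons c p)
  have "poly_op (pCons c p) A o\<^sub>L A = c *\<^sub>R A + (A o\<^sub>L (poly_op p A o\<^sub>L A))"
    by (intro blinfun_eqI) (simp add: poly_op_pCons blinfun.bilinear_simps)
  also have "\<dots> = A o\<^sub>L poly_op (pCons c p) A"
    unfolding pCons.IH by (intro blinfun_eqI) (simp add: poly_op_pCons blinfun.bilinear_simps)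
  finally show ?case .
qed (simp add: poly_op_0)

text \<open>
  A polynomial of the Laplacian has finite range of interaction, so it preserves finite support and
  acts on the transform as multiplication by the polynomial of the symbol.
\<close>

lemma sine_transform_poly_op:
  assumes "supp_below N u"
  shows "\<exists>M. supp_below M (poly_op p neg_laplacian u) \<and>
    (\<forall>\<theta>. sine_transform (poly_op p neg_laplacian u) \<theta> =
       of_real (poly p (2 - 2 * cos \<theta>)) * sine_transform u \<theta>)"
proof (induction p)
  case 0
  show ?case
    by (intro exI[of _ 0]) (simp add: poly_op_0 supp_below_def sine_transform_def)
next
  case (pCons c p)
  then obtain M where M: "supp_below M (poly_op p neg_laplacian u)"
    "\<And>\<theta>. sine_transform (poly_op p neg_laplacian u) \<theta> =
       of_real (poly p (2 - 2 * cos \<theta>)) * sine_transform u \<theta>"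
    by blast
  have eq: "poly_op (pCons c p) neg_laplacian u =
      c *\<^sub>R u + neg_laplacian (poly_op p neg_laplacian u)"
    by (simp add: poly_op_pCons blinfun.bilinear_simps)
  note c = sine_transform_scaleR[OF assms, of c]
  note s = supp_below_neg_laplacian[OF M(1)]
  show ?case
    unfolding eq sine_transform_add(1)[OF c(2) s] c(1) sine_transform_neg_laplacian[OF M(1)] M(2)
    using sine_transform_add(2)[OF c(2) s] by (auto simp: algebra_simps)
qed

text \<open>
  The form of \<open>p(-\<Delta>)\<close> is the integral of \<open>p\<close> against the spectral measure
  \<open>(2/\<pi>) \<bar>S u(\<theta>)\<bar>\<^sup>2 d\<theta>\<close> of \<open>u\<close>; in particular it is real.
\<close>

lemma poly_form_integral:
  assumes "supp_below N u"
  shows "((\<lambda>\<theta>. poly p (2 - 2 * cos \<theta>) * (cmod (sine_transform u \<theta>))\<^sup>2) has_integral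
      pi / 2 * inner u (poly_op p neg_laplacian u)) {0..pi}"
    and "Im (cinner u (poly_op p neg_laplacian u)) = 0"
proof -
  let ?g = "\<lambda>\<theta>. poly p (2 - 2 * cos \<theta>) * (cmod (sine_transform u \<theta>))\<^sup>2"
  obtain M where M: "supp_below M (poly_op p neg_laplacian u)"
    "\<And>\<theta>. sine_transform (poly_op p neg_laplacian u) \<theta> =
       of_real (poly p (2 - 2 * cos \<theta>)) * sine_transform u \<theta>"
    using sine_transform_poly_op[OF assms, of p] by blast
  have "cnj (sine_transform u \<theta>) * sine_transform (poly_op p neg_laplacian u) \<theta> = of_real (?g \<theta>)" for \<theta>
    unfolding M(2) of_real_mult complex_norm_square by (simp add: mult_ac)
  then have I: "((\<lambda>\<theta>. complex_of_real (?g \<theta>)) has_integral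
      of_real (pi / 2) * cinner u (poly_op p neg_laplacian u)) {0..pi}"
    using has_integral_cinner[OF assms M(1)] by (simp only:)
  show "(?g has_integral pi / 2 * inner u (poly_op p neg_laplacian u)) {0..pi}"
    using has_integral_linear[OF I bounded_linear_Re] by (simp add: o_def inner_ell2_def)
  have "((\<lambda>\<theta>. 0) has_integral pi / 2 * Im (cinner u (poly_op p neg_laplacian u))) {0..pi}"
    using has_integral_linear[OF I bounded_linear_Im] by (simp add: o_def)
  then show "Im (cinner u (poly_op p neg_laplacian u)) = 0"
    by (simp add: has_integral_0_eq)
qed

lemma has_integral_norm_sq:
  assumes "supp_below N u"
  shows "((\<lambda>\<theta>. (cmod (sine_transform u \<theta>))\<^sup>2) has_integral pi / 2 * (norm u)\<^sup>2) {0..pi}"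
  using poly_form_integral(1)[OF assms, of 1]
  by (simp add: one_pCons poly_op_pCons poly_op_0 power2_norm_eq_inner)

lemma laplacian_symbol_range: "2 - 2 * cos \<theta> \<in> {0..4}" for \<theta> :: real
  using cos_ge_minus_one[of \<theta>] cos_le_one[of \<theta>] unfolding atLeastAtMost_iff by linarith

text \<open>
  On finitely supported sequences the bound is the Parseval identity for the transform multiplied by
  \<open>p(2 - 2 cos \<theta>)\<close>; density extends it. Bounding \<open>p\<close> on the open interval is enough by
  continuity. This matters below: approximate eigenvectors are constructed for interior points
  only, so uniqueness in the functional calculus must not refer to the endpoints of the spectrum.
\<close>

lemma norm_poly_op_le:
  assumes "\<And>x. 0 < x \<Longrightarrow> x < 4 \<Longrightarrow> \<bar>poly p x\<bar> \<le> C"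
  shows "norm (poly_op p neg_laplacian) \<le> C"
proof -
  have C: "\<bar>poly p x\<bar> \<le> C" if "0 \<le> x" "x \<le> 4" for x
  proof (rule continuous_le_on_closure[where S = "{0<..<4}" and f = "\<lambda>x. \<bar>poly p x\<bar>"])
    show "x \<in> closure {0<..<4}" using that by simp
  qed (use assms in \<open>auto intro!: continuous_intros\<close>)
  have "0 \<le> C" using C[of 0] by linarith
  have fin: "norm (poly_op p neg_laplacian u) \<le> C * norm u" if u: "supp_below N u" for N u
  proof -
    obtain M where M: "supp_below M (poly_op p neg_laplacian u)"
      "\<And>\<theta>. sine_transform (poly_op p neg_laplacian u) \<theta> =
         of_real (poly p (2 - 2 * cos \<theta>)) * sine_transform u \<theta>"
      using sine_transform_poly_op[OF u, of p] by blast
    have "pi / 2 * (norm (poly_op p neg_laplacian u))\<^sup>2 \<le> C\<^sup>2 * (pi / 2 * (norm u)\<^sup>2)"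
    proof (rule has_integral_le[OF has_integral_norm_sq[OF M(1)]
          has_integral_mult_right[OF has_integral_norm_sq[OF u]]])
      fix \<theta> :: real
      have "\<bar>poly p (2 - 2 * cos \<theta>)\<bar>\<^sup>2 \<le> C\<^sup>2"
        using laplacian_symbol_range[of \<theta>] by (intro power_mono C) auto
      then show "(cmod (sine_transform (poly_op p neg_laplacian u) \<theta>))\<^sup>2 \<le> C\<^sup>2 * (cmod (sine_transform u \<theta>))\<^sup>2"
        unfolding M(2) norm_mult norm_of_real power_mult_distrib by (intro mult_right_mono) auto
    qed
    then have "(norm (poly_op p neg_laplacian u))\<^sup>2 \<le> (C * norm u)\<^sup>2"
      by (simp add: power_mult_distrib)
    then show ?thesis
      by (rule power2_le_imp_le) (simp add: \<open>0 \<le> C\<close>)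
  qed
  show ?thesis
  proof (rule norm_blinfun_bound[OF \<open>0 \<le> C\<close>])
    fix u
    show "norm (poly_op p neg_laplacian u) \<le> C * norm u"
    proof (rule LIMSEQ_le)
      show "(\<lambda>N. norm (poly_op p neg_laplacian (trunc N u))) \<longlonglongrightarrow> norm (poly_op p neg_laplacian u)"
        "(\<lambda>N. C * norm (trunc N u)) \<longlonglongrightarrow> C * norm u"
        by (intro tendsto_intros tendsto_trunc)+
    qed (use fin[OF supp_below_trunc] in blast)
  qed
qed

section \<open>The spectrum and the functional calculus of the Laplacian\<close>

lemma poly_op_cauchy:
  assumes "uniform_limit {0<..<4} (\<lambda>n. poly (p n)) f sequentially"
  shows "Cauchy (\<lambda>n. poly_op (p n) neg_laplacian)"
proof (rule CauchyI)
  fix e :: real assume "0 < e"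
  have "uniformly_Cauchy_on {0<..<4} (\<lambda>n. poly (p n))"
    using assms by (intro uniformly_convergent_Cauchy uniformly_convergentI)
  then obtain M where M: "\<And>x m n. 0 < x \<Longrightarrow> x < 4 \<Longrightarrow> m \<ge> M \<Longrightarrow> n \<ge> M \<Longrightarrow> dist (poly (p m) x) (poly (p n) x) < e / 2"
    unfolding uniformly_Cauchy_on_def using \<open>0 < e\<close> half_gt_zero by (metis greaterThanLessThan_iff)
  have "norm (poly_op (p m) neg_laplacian - poly_op (p n) neg_laplacian) \<le> e / 2" if "m \<ge> M" "n \<ge> M" for m n
    unfolding poly_op_diff[symmetric]
    using M that by (intro norm_poly_op_le) (auto simp: dist_real_def intro: less_imp_le)
  then show "\<exists>M. \<forall>m\<ge>M. \<forall>n\<ge>M. norm (poly_op (p m) neg_laplacian - poly_op (p n) neg_laplacian) < e"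
    using \<open>0 < e\<close> by (intro exI[of _ M]) force
qed

text \<open>
  Two sequences of polynomials with the same uniform limit differ by polynomials that tend to 0
  uniformly, hence by operators that tend to 0 in norm.
\<close>

lemma poly_op_limit_unique:
  assumes p: "uniform_limit {0<..<4} (\<lambda>n. poly (p n)) f sequentially"
    and q: "uniform_limit {0<..<4} (\<lambda>n. poly (q n)) f sequentially"
    and T: "(\<lambda>n. poly_op (p n) neg_laplacian) \<longlonglongrightarrow> T"
  shows "(\<lambda>n. poly_op (q n) neg_laplacian) \<longlonglongrightarrow> T"
proof -
  have lim: "uniform_limit {0<..<4} (\<lambda>n x. poly (q n) x - poly (p n) x) (\<lambda>x. f x - f x) sequentially"
    by (intro uniform_limit_intros p q)
  have "(\<lambda>n. poly_op (q n - p n) neg_laplacian) \<longlonglongrightarrow> 0"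
    unfolding tendsto_iff
  proof (intro allI impI)
    fix e :: real assume "0 < e"
    from uniform_limitD[OF lim, of "e / 2"] \<open>0 < e\<close>
    have "\<forall>\<^sub>F n in sequentially. \<forall>x\<in>{0<..<4}. \<bar>poly (q n - p n) x\<bar> < e / 2"
      by (simp add: dist_real_def)
    then show "\<forall>\<^sub>F n in sequentially. dist (poly_op (q n - p n) neg_laplacian) 0 < e"
    proof eventually_elim
      case (elim n)
      then have "norm (poly_op (q n - p n) neg_laplacian) \<le> e / 2"
        by (intro norm_poly_op_le less_imp_le) auto
      then show ?case
        using \<open>0 < e\<close> by simp
    qed
  qed
  then have "(\<lambda>n. poly_op (q n - p n) neg_laplacian + poly_op (p n) neg_laplacian) \<longlonglongrightarrow> 0 + T"
    by (intro tendsto_add T)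
  then show ?thesis
    by (simp add: poly_op_diff)
qed

lemma polynomials_approximating:
  fixes f :: "real \<Rightarrow> real"
  assumes "compact S" "continuous_on S f"
  shows "\<exists>p. uniform_limit S (\<lambda>n. poly (p n)) f sequentially"
proof -
  have "\<exists>q. \<forall>x\<in>S. \<bar>f x - poly q x\<bar> < e" if "0 < e" for e
  proof -
    obtain g where g: "real_polynomial_function g" "\<And>x. x \<in> S \<Longrightarrow> \<bar>f x - g x\<bar> < e"
      using Stone_Weierstrass_real_polynomial_function[OF assms \<open>0 < e\<close>] by blast
    then obtain a k where "g = (\<lambda>x. \<Sum>i\<le>k. a i * x ^ i)"
      unfolding real_polynomial_function_iff_sum by blast
    then have "g = poly (\<Sum>i\<le>k. monom (a i) i)"
      by (simp add: fun_eq_iff poly_sum poly_monom)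
    with g(2) show ?thesis by blast
  qed
  then have "\<forall>n. \<exists>q. \<forall>x\<in>S. \<bar>f x - poly q x\<bar> < inverse (real (Suc n))"
    by simp
  then obtain p where p: "\<And>n x. x \<in> S \<Longrightarrow> \<bar>f x - poly (p n) x\<bar> < inverse (real (Suc n))"
    by metis
  have "uniform_limit S (\<lambda>n. poly (p n)) f sequentially"
  proof (rule uniform_limitI)
    fix e :: real assume "0 < e"
    then have "\<forall>\<^sub>F n in sequentially. inverse (real (Suc n)) < e"
      using LIMSEQ_inverse_real_of_nat order_tendstoD(2) by blast
    then show "\<forall>\<^sub>F n in sequentially. \<forall>x\<in>S. dist (poly (p n) x) (f x) < e"
    proof eventually_elim
      case (elim n)
      then show ?case
        using p[of _ n] by (force simp: dist_real_def abs_minus_commute)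
    qed
  qed
  then show ?thesis by blast
qed

lemma cscale_op_of_real: "cscale_op (of_real x) = x *\<^sub>R id_blinfun"
  by (intro blinfun_eqI ell2_eqI) (simp add: cscale_op.rep_eq cscale.rep_eq blinfun.bilinear_simps)

text \<open>
  For real \<open>x\<close> outside \<open>[0,4]\<close> the function \<open>t \<mapsto> 1/(t - x)\<close> is continuous on \<open>[0,4]\<close>. The same
  calculus that is being constructed then provides the inverse of \<open>-\<Delta> - x\<close> as a limit of
  polynomials in \<open>-\<Delta>\<close>.
\<close>

lemma real_spectrum_upper: "{x. complex_of_real x \<in> spectrum neg_laplacian} \<subseteq> {0..4}"
proof (rule subsetI, rule ccontr)
  fix x assume x: "x \<in> {x. complex_of_real x \<in> spectrum neg_laplacian}" "x \<notin> {0..4}"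
  let ?A = "neg_laplacian - cscale_op (of_real x)"
  define f where "f t = inverse (t - x)" for t
  have f: "continuous_on {0..4} f"
    unfolding f_def using x(2) by (intro continuous_intros) auto
  obtain p where p: "uniform_limit {0..4} (\<lambda>n. poly (p n)) f sequentially"
    using polynomials_approximating[OF _ f] by auto
  have "uniform_limit {0<..<4} (\<lambda>n. poly (p n)) f sequentially"
    using p by (rule uniform_limit_on_subset) auto
  then obtain B where B: "(\<lambda>n. poly_op (p n) neg_laplacian) \<longlonglongrightarrow> B"
    using Cauchy_convergent[OF poly_op_cauchy] unfolding convergent_def by blast
  define q where "q n = pCons 0 (p n) - smult x (p n)" for n
  have "uniform_limit {0..4} (\<lambda>n t. (t - x) * poly (p n) t) (\<lambda>t. (t - x) * f t) sequentially"
    by (intro uniform_lim_mult p uniform_limit_const compact_imp_bounded compact_continuous_image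
        continuous_intros f compact_Icc)
  then have "uniform_limit {0<..<4} (\<lambda>n t. (t - x) * poly (p n) t) (\<lambda>t. (t - x) * f t) sequentially"
    by (rule uniform_limit_on_subset) auto
  moreover have "poly (q n) t = (t - x) * poly (p n) t" for n t
    by (simp add: q_def algebra_simps)
  moreover have "(t - x) * f t = 1" if "t \<in> {0<..<4}" for t
    using that x(2) by (auto simp: f_def)
  ultimately have "uniform_limit {0<..<4} (\<lambda>n. poly (q n)) (\<lambda>_. 1) sequentially"
    by (subst uniform_limit_cong'[where g = "\<lambda>n t. (t - x) * poly (p n) t" and i = "\<lambda>t. (t - x) * f t"]) auto
  moreover have "uniform_limit {0<..<4::real} (\<lambda>n. poly 1) (\<lambda>_. 1) sequentially"
    by (rule uniform_limitI) simp
  moreover have "(\<lambda>n. poly_op 1 neg_laplacian) \<longlonglongrightarrow> id_blinfun"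
    by (simp add: one_pCons poly_op_pCons poly_op_0)
  ultimately have q: "(\<lambda>n. poly_op (q n) neg_laplacian) \<longlonglongrightarrow> id_blinfun"
    using poly_op_limit_unique[of "\<lambda>n. 1" "\<lambda>_. 1" q id_blinfun] by simp
  have q1: "poly_op (q n) neg_laplacian = ?A o\<^sub>L poly_op (p n) neg_laplacian" for n
    by (intro blinfun_eqI)
       (simp add: q_def poly_op_diff poly_op_pCons poly_op_smult cscale_op_of_real blinfun.bilinear_simps)
  have q2: "poly_op (q n) neg_laplacian = poly_op (p n) neg_laplacian o\<^sub>L ?A" for n
    unfolding q_def poly_op_diff poly_op_pCons poly_op_smult cscale_op_of_real
      poly_op_commute[of "p n", symmetric]
    by (intro blinfun_eqI) (simp add: blinfun.bilinear_simps)
  have "(\<lambda>n. ?A o\<^sub>L poly_op (p n) neg_laplacian) \<longlonglongrightarrow> (?A o\<^sub>L B)"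
    "(\<lambda>n. poly_op (p n) neg_laplacian o\<^sub>L ?A) \<longlonglongrightarrow> (B o\<^sub>L ?A)"
    by (intro blinfun_compose.tendsto tendsto_const B)+
  then have "?A o\<^sub>L B = id_blinfun" "B o\<^sub>L ?A = id_blinfun"
    using q LIMSEQ_unique by (simp_all only: q1[symmetric] q2[symmetric]) blast+
  with x(1) show False
    unfolding spectrum_def by blast
qed

text \<open>
  For \<open>x = 2 - 2 cos \<phi>\<close> the sequence \<open>sin (n\<phi>)\<close> is a bounded solution of \<open>-\<Delta>u = xu\<close>. Cutting it off
  after \<open>N\<close> leaves an error supported in the two places \<open>N\<close> and \<open>N + 1\<close>, of norm at most \<open>\<surd>2\<close>. A
  bounded left inverse of \<open>-\<Delta> - x\<close> would thus bound the sums of \<open>sin\<^sup>2 (n\<phi>)\<close> uniformly in \<open>N\<close>, so that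
  \<open>sin (n\<phi>)\<close> tends to 0. This is impossible for \<open>0 < \<phi> < \<pi>\<close>, because consecutive values satisfy
  \<open>\<bar>sin \<phi>\<bar> \<le> \<bar>sin ((n+1)\<phi>)\<bar> + \<bar>sin (n\<phi>)\<bar>\<close>.
\<close>

lemma real_spectrum_lower: "{0<..<4} \<subseteq> {x. complex_of_real x \<in> spectrum neg_laplacian}"
proof (rule subsetI, rule ccontr)
  fix x :: real assume x: "x \<in> {0<..<4}" "x \<notin> {x. complex_of_real x \<in> spectrum neg_laplacian}"
  let ?A = "neg_laplacian - cscale_op (of_real x)"
  obtain B where B: "B o\<^sub>L ?A = id_blinfun"
    using x(2) unfolding spectrum_def by auto
  define \<phi> where "\<phi> = arccos (1 - x / 2)"
  have \<phi>: "0 < \<phi>" "\<phi> < pi" "x = 2 - 2 * cos \<phi>"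
    using x(1) arccos_lt_bounded[of "1 - x / 2"] by (auto simp: \<phi>_def)
  define a where "a n = sin (real n * \<phi>)" for n
  have rec: "a (Suc (Suc n)) = (2 - x) * a (Suc n) - a n" for n
    unfolding a_def \<phi>(3) using sin_add[of "real (Suc n) * \<phi>" \<phi>] sin_diff[of "real (Suc n) * \<phi>" \<phi>]
    by (simp add: algebra_simps)
  have a1: "(a n)\<^sup>2 \<le> 1" for n
    by (simp add: a_def abs_square_le_1)
  have bound: "(\<Sum>n<Suc N. (a n)\<^sup>2) \<le> 2 * (norm B)\<^sup>2" for N
  proof -
    define u where "u = Abs_ell2 (\<lambda>n. if n \<le> N then of_real (a n) else 0)"
    have su: "seq u n = (if n \<le> N then of_real (a n) else 0)" for n
      unfolding u_def
      by (subst Abs_ell2_inverse) (auto simp: a_def intro!: summable_finite[of "{..N}"] split: if_splits)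
    have supp: "supp_below (Suc N) u"
      by (simp add: supp_below_def su)
    have Au: "seq (?A u) n = (if n = N then of_real (a (Suc N)) else if n = Suc N then - of_real (a N) else 0)"
      if "0 < n \<or> N \<noteq> 0" for n
    proof (cases n)
      case 0
      then show ?thesis using that by simp
    next
      case (Suc m)
      have A: "seq (?A u) n = - seq u m + 2 * seq u (Suc m) - seq u (Suc (Suc m)) - of_real x * seq u (Suc m)"
        using Suc by (simp add: cscale_op_of_real blinfun.bilinear_simps neg_laplacian.rep_eq neg_laplacian_fun.rep_eq)
      have a: "complex_of_real (a (Suc (Suc m))) = (2 - of_real x) * of_real (a (Suc m)) - of_real (a m)"
        unfolding rec by simp
      consider "Suc m < N" | "Suc m = N" | "m = N" | "N < m"
        by linarith
      then show ?thesis
        unfolding A unfolding Suc su using a by cases (auto simp: algebra_simps)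
    qed
    show ?thesis
    proof (cases "N = 0")
      case True
      then show ?thesis by (simp add: a_def)
    next
      case False
      have "(norm (?A u))\<^sup>2 = (\<Sum>n<Suc (Suc N). (cmod (seq (?A u) n))\<^sup>2)"
        using Au False by (intro norm_supp_below) (simp add: supp_below_def)
      also have "\<dots> = (a (Suc N))\<^sup>2 + (a N)\<^sup>2"
        using False by (simp add: Au)
      also have "\<dots> \<le> 2"
        using a1[of N] a1[of "Suc N"] by linarith
      finally have A2: "(norm (?A u))\<^sup>2 \<le> 2" .
      have "(\<Sum>n<Suc N. (a n)\<^sup>2) = (norm u)\<^sup>2"
        unfolding norm_supp_below[OF supp] by (intro sum.cong) (auto simp: su)
      also have "u = B (?A u)"
        using arg_cong[OF B, of "\<lambda>T. T u"] by simp
      also have "(norm (B (?A u)))\<^sup>2 \<le> (norm B * norm (?A u))\<^sup>2"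
        by (intro power_mono norm_blinfun) simp
      also have "\<dots> \<le> 2 * (norm B)\<^sup>2"
        using mult_left_mono[OF A2, of "(norm B)\<^sup>2"] by (simp add: power_mult_distrib mult.commute)
      finally show ?thesis .
    qed
  qed
  have "(\<Sum>n<N. (a n)\<^sup>2) \<le> 2 * (norm B)\<^sup>2" for N
    using bound[of N] zero_le_power2[of "a N"] unfolding sum.lessThan_Suc by linarith
  then have "summable (\<lambda>n. (a n)\<^sup>2)"
    by (intro summableI_nonneg_bounded[where x = "2 * (norm B)\<^sup>2"]) auto
  then have "(\<lambda>n. (a n)\<^sup>2) \<longlonglongrightarrow> 0"
    by (rule summable_LIMSEQ_zero)
  then have lim: "a \<longlonglongrightarrow> 0"
    by (simp add: tendsto_rabs_zero_iff power_tendsto_0_iff)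
  have "(\<lambda>n. \<bar>a (Suc n)\<bar> + \<bar>a n\<bar>) \<longlonglongrightarrow> \<bar>0\<bar> + \<bar>0\<bar>"
    by (intro tendsto_intros lim LIMSEQ_Suc)
  moreover have "\<bar>sin \<phi>\<bar> \<le> \<bar>a (Suc n)\<bar> + \<bar>a n\<bar>" for n
  proof -
    have "sin \<phi> = a (Suc n) * cos (real n * \<phi>) - cos (real (Suc n) * \<phi>) * a n"
      unfolding a_def sin_diff[symmetric] by (simp add: algebra_simps)
    also have "\<bar>\<dots>\<bar> \<le> \<bar>a (Suc n) * cos (real n * \<phi>)\<bar> + \<bar>cos (real (Suc n) * \<phi>) * a n\<bar>"
      by (rule abs_triangle_ineq4)
    also have "\<dots> \<le> \<bar>a (Suc n)\<bar> + \<bar>a n\<bar>"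
      by (intro add_mono) (simp_all add: abs_mult mult_left_le mult_left_le_one_le)
    finally show ?thesis .
  qed
  ultimately have "\<bar>sin \<phi>\<bar> \<le> \<bar>0\<bar> + \<bar>0\<bar>"
    by (intro LIMSEQ_le_const) auto
  with sin_gt_zero[OF \<phi>(1,2)] show False
    by simp
qed

text \<open>
  The description that defines \<^const>\<open>fun_calc\<close> has exactly one solution: the inclusion of the real
  spectrum in \<open>[0,4]\<close> gives existence, and its containing \<open>(0,4)\<close> gives uniqueness.
\<close>

lemma fun_calc_laplacian:
  assumes "continuous_on {0..4} f"
  shows "\<exists>p. uniform_limit {0..4} (\<lambda>n. poly (p n)) f sequentially \<and>
     (\<lambda>n. poly_op (p n) neg_laplacian) \<longlonglongrightarrow> fun_calc f neg_laplacian"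
proof -
  let ?S = "{x. complex_of_real x \<in> spectrum neg_laplacian}"
  obtain p where p: "uniform_limit {0..4} (\<lambda>n. poly (p n)) f sequentially"
    using polynomials_approximating[OF _ assms] by auto
  have p1: "uniform_limit {0<..<4} (\<lambda>n. poly (p n)) f sequentially"
    using p by (rule uniform_limit_on_subset) auto
  then obtain T where T: "(\<lambda>n. poly_op (p n) neg_laplacian) \<longlonglongrightarrow> T"
    using Cauchy_convergent[OF poly_op_cauchy] unfolding convergent_def by blast
  have "fun_calc f neg_laplacian = T"
    unfolding fun_calc_def
  proof (rule the_equality)
    show "\<exists>p. uniform_limit ?S (\<lambda>n. poly (p n)) f sequentially \<and> (\<lambda>n. poly_op (p n) neg_laplacian) \<longlonglongrightarrow> T"
      using uniform_limit_on_subset[OF p real_spectrum_upper] T by blast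
  next
    fix T'
    assume "\<exists>p. uniform_limit ?S (\<lambda>n. poly (p n)) f sequentially \<and> (\<lambda>n. poly_op (p n) neg_laplacian) \<longlonglongrightarrow> T'"
    then obtain q where q: "uniform_limit ?S (\<lambda>n. poly (q n)) f sequentially"
      and T': "(\<lambda>n. poly_op (q n) neg_laplacian) \<longlonglongrightarrow> T'"
      by blast
    have "(\<lambda>n. poly_op (q n) neg_laplacian) \<longlonglongrightarrow> T"
      using poly_op_limit_unique[OF p1 uniform_limit_on_subset[OF q real_spectrum_lower] T] .
    with T' show "T' = T"
      by (rule LIMSEQ_unique)
  qed
  with p T show ?thesis by blast
qed

text \<open>
  The spectral representation of the form passes from polynomials to continuous functions, because
  uniform convergence commutes with the integral over \<open>[0,\<pi>]\<close>.
\<close>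

lemma form_integral:
  assumes f: "continuous_on {0..4} f" and u: "supp_below N u"
  shows "((\<lambda>\<theta>. f (2 - 2 * cos \<theta>) * (cmod (sine_transform u \<theta>))\<^sup>2) has_integral
      pi / 2 * inner u (fun_calc f neg_laplacian u)) {0..pi}"
    and "Im (cinner u (fun_calc f neg_laplacian u)) = 0"
proof -
  obtain p where p: "uniform_limit {0..4} (\<lambda>n. poly (p n)) f sequentially"
    and T: "(\<lambda>n. poly_op (p n) neg_laplacian) \<longlonglongrightarrow> fun_calc f neg_laplacian"
    using fun_calc_laplacian[OF f] by blast
  have lim: "(\<lambda>n. cinner u (poly_op (p n) neg_laplacian u)) \<longlonglongrightarrow> cinner u (fun_calc f neg_laplacian u)"
    by (intro tendsto_cinner blinfun.tendsto tendsto_const T)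
  have "(\<lambda>n. Im (cinner u (poly_op (p n) neg_laplacian u))) \<longlonglongrightarrow> Im (cinner u (fun_calc f neg_laplacian u))"
    by (intro tendsto_intros lim)
  then show "Im (cinner u (fun_calc f neg_laplacian u)) = 0"
    by (simp add: poly_form_integral(2)[OF u] LIMSEQ_const_iff)
  have symbol: "(\<lambda>\<theta>. 2 - 2 * cos \<theta>) \<in> S \<rightarrow> {0..4}" for S :: "real set"
    using laplacian_symbol_range by blast
  have fc: "continuous_on {0..pi} (\<lambda>\<theta>. f (2 - 2 * cos \<theta>))"
    by (intro continuous_on_compose2[OF f] continuous_intros) (use laplacian_symbol_range in blast)
  have sc: "continuous_on {0..pi} (\<lambda>\<theta>. (cmod (sine_transform u \<theta>))\<^sup>2)"
    by (intro continuous_intros continuous_on_sine_transform[OF u])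
  have "uniform_limit {0..pi} (\<lambda>n \<theta>. poly (p n) (2 - 2 * cos \<theta>) * (cmod (sine_transform u \<theta>))\<^sup>2)
     (\<lambda>\<theta>. f (2 - 2 * cos \<theta>) * (cmod (sine_transform u \<theta>))\<^sup>2) sequentially"
    by (intro uniform_lim_mult uniform_limit_compose'[OF p symbol] uniform_limit_const
        compact_imp_bounded compact_continuous_image compact_Icc fc sc)
  then obtain I J where I: "\<And>n. ((\<lambda>\<theta>. poly (p n) (2 - 2 * cos \<theta>) * (cmod (sine_transform u \<theta>))\<^sup>2) has_integral I n) {0..pi}"
    and J: "((\<lambda>\<theta>. f (2 - 2 * cos \<theta>) * (cmod (sine_transform u \<theta>))\<^sup>2) has_integral J) {0..pi}"
    and IJ: "I \<longlonglongrightarrow> J"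
    by (rule uniform_limit_integral) (auto intro!: continuous_intros sc)
  have "I = (\<lambda>n. pi / 2 * inner u (poly_op (p n) neg_laplacian u))"
    using has_integral_unique[OF I poly_form_integral(1)[OF u]] by (intro ext)
  moreover have "(\<lambda>n. pi / 2 * Re (cinner u (poly_op (p n) neg_laplacian u))) \<longlonglongrightarrow>
      pi / 2 * Re (cinner u (fun_calc f neg_laplacian u))"
    by (intro tendsto_intros lim)
  ultimately have "I \<longlonglongrightarrow> pi / 2 * inner u (fun_calc f neg_laplacian u)"
    by (simp only: inner_ell2_def)
  with IJ have "J = pi / 2 * inner u (fun_calc f neg_laplacian u)"
    by (rule LIMSEQ_unique)
  with J show "((\<lambda>\<theta>. f (2 - 2 * cos \<theta>) * (cmod (sine_transform u \<theta>))\<^sup>2) has_integral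
      pi / 2 * inner u (fun_calc f neg_laplacian u)) {0..pi}"
    by simp
qed

section \<open>Pointwise bounds by the energy\<close>

text \<open>
  A geometric interpolation between the bounds 1 and \<open>x\<^sup>2\<close>. It replaces the splitting of an integral at
  \<open>\<theta> = 1/n\<close> by a single power of \<open>\<theta>\<close>.
\<close>

lemma sin_sq_le_powr:
  fixes x s :: real
  assumes "0 \<le> x" "0 \<le> s" "s \<le> 2"
  shows "(sin x)\<^sup>2 \<le> x powr s"
proof (cases "x \<le> 1")
  case True
  have "(sin x)\<^sup>2 \<le> x\<^sup>2"
    using abs_sin_x_le_abs_x[of x] by (simp add: abs_le_square_iff)
  also have "x\<^sup>2 = x powr 2"
    using assms(1) by simp
  also have "\<dots> \<le> x powr s"
    using assms True by (intro powr_mono') auto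
  finally show ?thesis .
next
  case False
  have "(sin x)\<^sup>2 \<le> 1"
    by (simp add: abs_square_le_1)
  also have "1 \<le> x powr s"
    using False assms by (intro ge_one_powr_ge_zero) auto
  finally show ?thesis .
qed

lemma laplacian_symbol_ge:
  assumes "0 \<le> \<theta>" "\<theta> \<le> pi"
  shows "\<theta>\<^sup>2 / 9 \<le> 2 - 2 * cos \<theta>"
proof -
  define x where "x = \<theta> / 2"
  have x: "0 \<le> x" "x \<le> 2"
    using assms pi_less_4 by (auto simp: x_def)
  \<comment> \<open>The crude constant 1/9 comes from \<open>\<pi> < 4\<close>: on \<open>[0,2]\<close> the Taylor error
      \<open>x\<^sup>3/6\<close> is at most \<open>2x/3\<close>.\<close>
  have "\<bar>sin x - x\<bar> \<le> x ^ 3 / 6"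
    using Maclaurin_sin_bound[of x 3] x(1)
    by (simp add: numeral_eq_Suc sin_coeff_def field_simps)
  moreover have "x ^ 3 \<le> 4 * x"
    using mult_mono[of x 2 x 2] mult_right_mono[of "x * x" 4 x] x by (simp add: numeral_eq_Suc)
  ultimately have "x / 3 \<le> sin x"
    by linarith
  then have "(x / 3)\<^sup>2 \<le> (sin x)\<^sup>2"
    using x(1) by (intro power_mono) auto
  moreover have "2 - 2 * cos \<theta> = 4 * (sin x)\<^sup>2"
    using cos_double_sin[of x] by (simp add: x_def)
  ultimately show ?thesis
    by (simp add: x_def power2_eq_square)
qed

lemma sin_sq_le_symbol:
  assumes "0 < \<alpha>" "0 \<le> s" "s \<le> 2" "0 \<le> \<theta>" "\<theta> \<le> pi"
  shows "(sin (real n * \<theta>))\<^sup>2 \<le>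
    (2 - 2 * cos \<theta>) powr \<alpha> * (9 powr \<alpha> * real n powr s * \<theta> powr (s - 2 * \<alpha>))"
proof (cases "\<theta> = 0")
  case False
  then have \<theta>: "0 < \<theta>" using assms by simp
  have "(sin (real n * \<theta>))\<^sup>2 \<le> (real n * \<theta>) powr s"
    using assms by (intro sin_sq_le_powr) auto
  also have "\<dots> = (\<theta>\<^sup>2 / 9) powr \<alpha> * (9 powr \<alpha> * real n powr s * \<theta> powr (s - 2 * \<alpha>))"
  proof -
    have "(\<theta>\<^sup>2 / 9) powr \<alpha> * 9 powr \<alpha> = (\<theta> powr 2) powr \<alpha>"
      using \<theta> by (simp add: powr_divide)
    then have "(\<theta>\<^sup>2 / 9) powr \<alpha> * 9 powr \<alpha> * \<theta> powr (s - 2 * \<alpha>) = \<theta> powr s"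
      by (simp add: powr_powr flip: powr_add)
    then show ?thesis
      by (simp add: powr_mult mult_ac)
  qed
  also have "\<dots> \<le> (2 - 2 * cos \<theta>) powr \<alpha> * (9 powr \<alpha> * real n powr s * \<theta> powr (s - 2 * \<alpha>))"
    using laplacian_symbol_ge[of \<theta>] assms by (intro mult_right_mono powr_mono2) auto
  finally show ?thesis .
qed simp

lemma continuous_on_powr_exponent:
  "0 < \<alpha> \<Longrightarrow> continuous_on {0..4::real} (\<lambda>x. x powr \<alpha>)"
  by (intro continuous_on_powr' continuous_intros) auto

lemma energy_nonneg:
  assumes "0 < \<alpha>" "supp_below N u"
  shows "0 \<le> inner u (neg_laplacian_pow \<alpha> u)"
proof -
  have "0 \<le> pi / 2 * inner u (neg_laplacian_pow \<alpha> u)"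
    unfolding neg_laplacian_pow_def
    by (rule has_integral_nonneg[OF form_integral(1)[OF continuous_on_powr_exponent[OF assms(1)] assms(2)]]) simp
  then show ?thesis
    using pi_gt_zero by (auto simp: zero_le_mult_iff)
qed

text \<open>
  The form in which the Cauchy--Schwarz inequality is used under the integral: \<open>K\<close> stands for a majorant of
  \<open>b\<^sup>2/w\<close>, and this formulation needs no division by the weight \<open>w\<close>, which vanishes at \<open>\<theta> = 0\<close>.
\<close>

lemma weighted_am_gm:
  fixes a b w K c :: real
  assumes "b\<^sup>2 \<le> w * K" "0 \<le> w" "0 \<le> K" "0 < c"
  shows "2 * (\<bar>a\<bar> * \<bar>b\<bar>) \<le> c * (w * a\<^sup>2) + K / c"
proof -
  have "\<bar>b\<bar> \<le> sqrt w * sqrt K"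
    unfolding real_sqrt_mult[symmetric] using assms(1) by (intro real_le_rsqrt) simp
  then have "2 * (\<bar>a\<bar> * \<bar>b\<bar>) \<le> 2 * (\<bar>a\<bar> * (sqrt w * sqrt K))"
    by (intro mult_left_mono) auto
  also have "\<dots> = 2 * (sqrt c * sqrt w * \<bar>a\<bar>) * (sqrt K / sqrt c)"
    using assms(4) by (simp add: field_simps)
  also have "\<dots> \<le> (sqrt c * sqrt w * \<bar>a\<bar>)\<^sup>2 + (sqrt K / sqrt c)\<^sup>2"
    by (rule sum_squares_bound)
  also have "\<dots> = c * (w * a\<^sup>2) + K / c"
    using assms by (simp add: power_mult_distrib power_divide)
  finally show ?thesis .
qed

text \<open>
  By Cauchy--Schwarz, the square of \<open>u\<^sub>n = (2/\<pi>) \<integral> S u(\<theta>) sin (n\<theta>) d\<theta>\<close> is at most a constant times the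
  energy \<open>\<integral> (2 - 2 cos \<theta>) powr \<alpha> \<bar>S u(\<theta>)\<bar>\<^sup>2 d\<theta>\<close> times \<open>\<integral> sin\<^sup>2 (n\<theta>) (2 - 2 cos \<theta>) powr (-\<alpha>) d\<theta>\<close>.
  The last integrand is at most a constant times \<open>n powr s * \<theta> powr (s - 2\<alpha>)\<close>, which is integrable at 0
  exactly when \<open>s > 2\<alpha> - 1\<close>.
\<close>

lemma coefficient_bound:
  assumes \<alpha>: "0 < \<alpha>" and s: "0 \<le> s" "s \<le> 2" "2 * \<alpha> - 1 < s" and u: "supp_below N u"
  shows "(cmod (seq u n))\<^sup>2 \<le> 2 / pi * (9 powr \<alpha> * pi powr (s - 2 * \<alpha> + 1) / (s - 2 * \<alpha> + 1)) *
    real n powr s * inner u (neg_laplacian_pow \<alpha> u)"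
proof (cases "seq u n = 0")
  case True
  then show ?thesis
    using s energy_nonneg[OF \<alpha> u] by simp
next
  case False
  then have n: "0 < n"
    by (metis gr0I seq_0)
  let ?q = "inner u (neg_laplacian_pow \<alpha> u)"
  let ?K = "9 powr \<alpha> * real n powr s"
  define b where "b = pi / 2 * cmod (seq u n)"
  define D where "D = ?K * (pi powr (s - 2 * \<alpha> + 1) / (s - 2 * \<alpha> + 1))"
  have b: "0 < b" using False by (simp add: b_def)
  have D: "0 < D" using n s by (simp add: D_def)
  have w: "((\<lambda>\<theta>. (2 - 2 * cos \<theta>) powr \<alpha> * (cmod (sine_transform u \<theta>))\<^sup>2) has_integral pi / 2 * ?q) {0..pi}"
    unfolding neg_laplacian_pow_def
    by (rule form_integral(1)[OF continuous_on_powr_exponent[OF \<alpha>] u])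
  have "((\<lambda>\<theta>. \<theta> powr (s - 2 * \<alpha>)) has_integral pi powr (s - 2 * \<alpha> + 1) / (s - 2 * \<alpha> + 1)) {0..pi}"
    using s by (intro has_integral_powr_from_0) auto
  then have K: "((\<lambda>\<theta>. ?K * \<theta> powr (s - 2 * \<alpha>)) has_integral D) {0..pi}"
    unfolding D_def by (rule has_integral_mult_right)
  \<comment> \<open>The weight \<open>c\<close> is free; this choice makes \<open>D / c = b\<close>, and the bound for \<open>2 * b\<close>
      becomes one for \<open>b\<^sup>2\<close> without a case distinction on the energy.\<close>
  define c where "c = D / b"
  have c: "0 < c" using b D by (simp add: c_def)
  have maj: "((\<lambda>\<theta>. (c * ((2 - 2 * cos \<theta>) powr \<alpha> * (cmod (sine_transform u \<theta>))\<^sup>2) + ?K * \<theta> powr (s - 2 * \<alpha>) / c) / 2)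
      has_integral (c * (pi / 2 * ?q) + D / c) / 2) {0..pi}"
    by (intro has_integral_divide has_integral_add has_integral_mult_right w K)
  note coeff = has_integral_sine_coefficient[OF u, of n]
  have "b = norm (integral {0..pi} (\<lambda>\<theta>. sine_transform u \<theta> * of_real (sin (real n * \<theta>))))"
    using coeff by (simp add: integral_unique b_def norm_mult)
  also have "\<dots> \<le> integral {0..pi} (\<lambda>\<theta>. (c * ((2 - 2 * cos \<theta>) powr \<alpha> * (cmod (sine_transform u \<theta>))\<^sup>2) +
      ?K * \<theta> powr (s - 2 * \<alpha>) / c) / 2)"
  proof (rule integral_norm_bound_integral[OF has_integral_integrable[OF coeff] has_integral_integrable[OF maj]])
    fix \<theta> assume "\<theta> \<in> {0..pi}"
    then have "2 * (\<bar>cmod (sine_transform u \<theta>)\<bar> * \<bar>sin (real n * \<theta>)\<bar>) \<le>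
        c * ((2 - 2 * cos \<theta>) powr \<alpha> * (cmod (sine_transform u \<theta>))\<^sup>2) + ?K * \<theta> powr (s - 2 * \<alpha>) / c"
      using \<alpha> s c by (intro weighted_am_gm sin_sq_le_symbol) auto
    then show "norm (sine_transform u \<theta> * of_real (sin (real n * \<theta>))) \<le>
        (c * ((2 - 2 * cos \<theta>) powr \<alpha> * (cmod (sine_transform u \<theta>))\<^sup>2) + ?K * \<theta> powr (s - 2 * \<alpha>) / c) / 2"
      by (simp add: norm_mult)
  qed
  also have "\<dots> = (c * (pi / 2 * ?q) + D / c) / 2"
    using maj by (rule integral_unique)
  finally have "2 * b \<le> D / b * (pi / 2 * ?q) + b"
    using D by (simp add: c_def)
  then have "b \<le> D * (pi / 2 * ?q) / b"
    by simp
  then have "b\<^sup>2 \<le> D * (pi / 2 * ?q)"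
    using b by (simp add: pos_le_divide_eq power2_eq_square)
  then have "(pi / 2)\<^sup>2 * (cmod (seq u n))\<^sup>2 \<le> (pi / 2)\<^sup>2 * (2 / pi * D * ?q)"
    by (simp add: b_def power_mult_distrib power2_eq_square)
  then have "(cmod (seq u n))\<^sup>2 \<le> 2 / pi * D * ?q"
    by (rule mult_left_le_imp_le) simp
  then show ?thesis
    by (simp add: D_def mult_ac)
qed

section \<open>The Hardy inequality\<close>

lemma cinner_diff_right: "cinner u (v - w) = cinner u v - cinner u w"
  by (simp add: cinner_eq_inner inner_diff_right complex_eq_iff)

lemma nonneg_form_from_dense:
  assumes "\<And>N u. supp_below N u \<Longrightarrow> cinner u (blinfun_apply T u) \<in> \<real>\<^sub>\<ge>\<^sub>0"
  shows "cinner u (blinfun_apply T u) \<in> \<real>\<^sub>\<ge>\<^sub>0"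
proof (rule closed_sequentially[OF closed_nonneg_Reals_complex])
  show "cinner (trunc N u) (blinfun_apply T (trunc N u)) \<in> \<real>\<^sub>\<ge>\<^sub>0" for N
    by (rule assms[OF supp_below_trunc])
  show "(\<lambda>N. cinner (trunc N u) (blinfun_apply T (trunc N u))) \<longlonglongrightarrow> cinner u (blinfun_apply T u)"
    by (intro tendsto_cinner blinfun.tendsto tendsto_const tendsto_trunc)
qed

theorem theorem1p4:
  fixes \<alpha> \<epsilon> :: real
  assumes "0 < \<alpha>" "\<alpha> < 3 / 2" "0 < \<epsilon>"
  shows "\<exists>\<gamma>>0. \<forall>\<psi>. cinner \<psi>
    ((neg_laplacian_pow \<alpha> - diag_op (\<lambda>n. \<gamma> / real n powr (max 1 (2 * \<alpha>) + \<epsilon>))) \<psi>) \<in> \<real>\<^sub>\<ge>\<^sub>0"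
proof -
  define m where "m = max 1 (2 * \<alpha>)"
  \<comment> \<open>The growth exponent \<open>s\<close> of the pointwise bounds has to exceed \<open>2\<alpha> - 1\<close> (integrability at
      \<open>\<theta> = 0\<close>) and to stay in \<open>[0,2]\<close> (bound for \<open>sin\<^sup>2\<close>) and below \<open>m - 1 + \<epsilon>\<close> (summability over
      \<open>n\<close>). The room that \<open>\<alpha> < 3/2\<close> and \<open>\<epsilon> > 0\<close> leave is what makes this possible.\<close>
  define s where "s = m - 1 + min (\<epsilon> / 2) (3 / 2 - \<alpha>)"
  have s: "0 \<le> s" "s \<le> 2" "2 * \<alpha> - 1 < s" "s - (m + \<epsilon>) < -1"
    using assms by (auto simp: s_def m_def min_def max_def field_simps)
  define C where "C = 2 / pi * (9 powr \<alpha> * pi powr (s - 2 * \<alpha> + 1) / (s - 2 * \<alpha> + 1))"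
  have C: "0 < C" using s by (simp add: C_def)
  have bound: "(cmod (seq u n))\<^sup>2 \<le> C * real n powr s * inner u (neg_laplacian_pow \<alpha> u)"
    if "supp_below N u" for N u n
    unfolding C_def by (rule coefficient_bound[OF assms(1) s(1-3) that])
  define Z where "Z = (\<Sum>n. real n powr (s - (m + \<epsilon>)))"
  have summ: "summable (\<lambda>n. real n powr (s - (m + \<epsilon>)))"
    using s(4) by (simp add: summable_real_powr_iff)
  have "0 < Z"
    unfolding Z_def by (rule suminf_pos2[OF summ, of 1]) auto
  define \<gamma> where "\<gamma> = 1 / (C * Z)"
  have \<gamma>: "0 < \<gamma>" using C \<open>0 < Z\<close> by (simp add: \<gamma>_def)
  define V where "V n = \<gamma> / real n powr (m + \<epsilon>)" for n
  have V0: "0 \<le> V n" for n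
    using \<gamma> by (simp add: V_def)
  have V_bound: "\<bar>V n\<bar> \<le> \<gamma>" for n
  proof (cases "n = 0")
    case False
    then have "1 \<le> real n powr (m + \<epsilon>)"
      using assms by (intro ge_one_powr_ge_zero) (auto simp: m_def)
    then show ?thesis
      using V0[of n] \<gamma> by (simp add: V_def divide_le_eq)
  qed (use \<gamma> in \<open>simp add: V_def\<close>)
  have main: "cinner u ((neg_laplacian_pow \<alpha> - diag_op V) u) \<in> \<real>\<^sub>\<ge>\<^sub>0" if u: "supp_below N u" for N u
  proof -
    let ?q = "inner u (neg_laplacian_pow \<alpha> u)"
    have q0: "0 \<le> ?q"
      by (rule energy_nonneg[OF assms(1) u])
    have "cinner u (diag_op V u) = (\<Sum>n<N. of_real (V n * (cmod (seq u n))\<^sup>2))"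
      unfolding cinner_supp_below[OF u] seq_diag_op[OF V_bound] of_real_mult complex_norm_square
      by (simp add: mult_ac)
    then have D: "cinner u (diag_op V u) = of_real (\<Sum>n<N. V n * (cmod (seq u n))\<^sup>2)"
      by simp
    have "(\<Sum>n<N. V n * (cmod (seq u n))\<^sup>2) \<le> (\<Sum>n<N. \<gamma> * C * ?q * real n powr (s - (m + \<epsilon>)))"
    proof (rule sum_mono)
      fix n
      have "V n * (cmod (seq u n))\<^sup>2 \<le> V n * (C * real n powr s * ?q)"
        by (rule mult_left_mono[OF bound[OF u] V0])
      also have "\<dots> = \<gamma> * C * ?q * real n powr (s - (m + \<epsilon>))"
        by (simp add: V_def powr_diff)
      finally show "V n * (cmod (seq u n))\<^sup>2 \<le> \<gamma> * C * ?q * real n powr (s - (m + \<epsilon>))" .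
    qed
    also have "\<dots> = \<gamma> * C * ?q * (\<Sum>n<N. real n powr (s - (m + \<epsilon>)))"
      by (simp add: sum_distrib_left)
    also have "\<dots> \<le> \<gamma> * C * ?q * Z"
      unfolding Z_def using \<gamma> C q0 by (intro mult_left_mono sum_le_suminf summ) auto
    also have "\<dots> = ?q"
      using C \<open>0 < Z\<close> by (simp add: \<gamma>_def)
    finally have "(\<Sum>n<N. V n * (cmod (seq u n))\<^sup>2) \<le> Re (cinner u (neg_laplacian_pow \<alpha> u))"
      by (simp add: inner_ell2_def)
    moreover have "Im (cinner u (neg_laplacian_pow \<alpha> u)) = 0"
      unfolding neg_laplacian_pow_def
      by (rule form_integral(2)[OF continuous_on_powr_exponent[OF assms(1)] u])
    ultimately show ?thesis
      by (simp add: complex_nonneg_Reals_iff blinfun.diff_left cinner_diff_right D)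
  qed
  have "\<forall>\<psi>. cinner \<psi> ((neg_laplacian_pow \<alpha> - diag_op V) \<psi>) \<in> \<real>\<^sub>\<ge>\<^sub>0"
    by (rule allI, rule nonneg_form_from_dense, rule main)
  then show ?thesis
    using \<gamma> unfolding V_def m_def by blast
qed

end
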